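(* Let $M\subseteq\mathbb{R}^d$ be a free $\mathbb{Z}$-module spanning $\mathbb{R}^d$ and $R\in\mathrm{O}(d,\mathbb{R})$. Then $\mathrm{Scal}_M(R)$ is a finitely generated free $\mathbb{Z}$-module, and $\beta\,\mathrm{Scal}_M(R)\subseteq\mathrm{Scal}_M(R)$ for every $\beta\in\mathrm{Scal}_M(E)$, so $\mathrm{Scal}_M(R)$ is a finitely generated $\mathrm{Scal}_M(E)$-module. If $\mathrm{Scal}_M(E)$ is a principal ideal domain, then $\mathrm{Scal}_M(R)$ is a free $\mathrm{Scal}_M(E)$-module of rank $1$, i.e. there exists $\alpha\in\mathrm{Scal}_M(R)$ with $\mathrm{Scal}_M(R)=\alpha\,\mathrm{Scal}_M(E)$.
   Context: A free $\mathbb{Z}$-module in $\mathbb{R}^d$ is $M=\langle t_1,\dots,t_k\rangle_{\mathbb{Z}}$ with $t_1,\dots,t_k\in\mathbb{R}^d$ rationally independent and spanning $\mathbb{R}^d$. For $R\in\mathrm{O}(d,\mathbb{R})$, $\mathrm{Scal}_M(R):=\{\alpha\in\mathbb{R}\mid\alpha RM\subseteq M\}$; $E$ denotes the identity, and $\mathrm{Scal}_M(E)$ is a ring.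
   Formalization: Freeness of rank 1 is claimed only when Scal_M(R) is not {0} (it can be {0}, e.g. M=Z^2 and a rotation with transcendental tangent); the existence of α with Scal_M(R)=α Scal_M(E) is proved in all cases. Also d≥1 is assumed, as the claim fails for d=0. *)

theory Defs
  imports "HOL-Analysis.Analysis" "HOL-Algebra.Algebra"
begin

text \<open>
  The submodule of \<open>\<real>\<^sup>d\<close> generated over the integers by finitely many rationally
  independent vectors that span \<open>\<real>\<^sup>d\<close> over the reals. The number \<open>k\<close> of generators
  may exceed \<open>d\<close>, so \<open>M\<close> need not be discrete.
\<close>

definition free_Z_module :: "(real ^ 'd) set \<Rightarrow> bool" where
  "free_Z_module M \<longleftrightarrow>
     (\<exists>(k::nat) (t :: nat \<Rightarrow> real ^ 'd).
        (\<forall>q :: nat \<Rightarrow> rat. (\<Sum>i<k. of_rat (q i) *\<^sub>R t i) = 0 \<longrightarrow> (\<forall>i<k. q i = 0)) \<and>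
        span (t ` {..<k}) = UNIV \<and>
        M = range (\<lambda>c :: nat \<Rightarrow> int. \<Sum>i<k. of_int (c i) *\<^sub>R t i))"

definition Scal :: "(real ^ 'd) set \<Rightarrow> real ^ 'd ^ 'd \<Rightarrow> real set" where
  "Scal M R = {\<alpha>. (\<lambda>x. \<alpha> *\<^sub>R (R *v x)) ` M \<subseteq> M}"

text \<open>
  Sets of reals as rings and as modules, with the operations inherited from \<open>\<real>\<close>.
  A module record also carries a multiplication and a unit; the module axioms do not
  mention them.
\<close>

definition real_subring :: "real set \<Rightarrow> real ring" where
  "real_subring A = \<lparr>carrier = A, mult = (*), one = 1, ring.zero = 0, ring.add = (+)\<rparr>"

definition real_submodule :: "real set \<Rightarrow> (real, real) module" where
  "real_submodule A =
     \<lparr>carrier = A, mult = (*), one = 1, ring.zero = 0, ring.add = (+), smult = (*)\<rparr>"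

definition real_Z_submodule :: "real set \<Rightarrow> (int, real) module" where
  "real_Z_submodule A =
     \<lparr>carrier = A, mult = (*), one = 1, ring.zero = 0, ring.add = (+), smult = (\<lambda>n x. of_int n * x)\<rparr>"

definition lincomb ::
    "('a, 'b, 'm) module_scheme \<Rightarrow> ('b \<Rightarrow> 'a) \<Rightarrow> 'b set \<Rightarrow> 'b" where
  "lincomb M c B = finsum M (\<lambda>b. c b \<odot>\<^bsub>M\<^esub> b) B"

definition finitely_generated_module ::
    "('a, 'r) ring_scheme \<Rightarrow> ('a, 'b, 'm) module_scheme \<Rightarrow> bool" where
  "finitely_generated_module R M \<longleftrightarrow>
     Module.module R M \<and>
     (\<exists>B. finite B \<and> B \<subseteq> carrier M \<and>
        (\<forall>x \<in> carrier M. \<exists>c \<in> B \<rightarrow>\<^sub>E carrier R. x = lincomb M c B))"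

text \<open>
  Coefficient families are extensional outside the basis, so that uniqueness only
  concerns their values on the basis.
\<close>

definition free_module_of_rank ::
    "('a, 'r) ring_scheme \<Rightarrow> ('a, 'b, 'm) module_scheme \<Rightarrow> nat \<Rightarrow> bool" where
  "free_module_of_rank R M n \<longleftrightarrow>
     Module.module R M \<and>
     (\<exists>B. finite B \<and> card B = n \<and> B \<subseteq> carrier M \<and>
        (\<forall>x \<in> carrier M. \<exists>!c. c \<in> B \<rightarrow>\<^sub>E carrier R \<and> x = lincomb M c B))"

end

theory Submission
  imports Defs
begin

text \<open>
  A scaling \<open>\<alpha>\<close> is determined by the integer coordinates of \<open>\<alpha> R t\<^sub>0\<close>, so \<open>Scal\<^sub>M(R)\<close> embeds
  additively into \<open>\<int>\<^sup>k\<close> and has a finite integral basis. For \<open>0 \<noteq> \<gamma> \<in> Scal\<^sub>M(R)\<close> the module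
  \<open>\<gamma> R M \<subseteq> M\<close> has the same rank as \<open>M\<close>, so \<open>m M \<subseteq> \<gamma> R M\<close> for some integer \<open>m > 0\<close>, that is,
  \<open>m/\<gamma> \<in> Scal\<^sub>M(R\<inverse>)\<close>. Multiplication by \<open>m/\<gamma>\<close> therefore maps \<open>Scal\<^sub>M(R)\<close> onto an ideal of
  \<open>Scal\<^sub>M(E)\<close>, and a generator of this ideal yields one of \<open>Scal\<^sub>M(R)\<close>.
\<close>

section \<open>Integral bases of additive subgroups\<close>

text \<open>Additive subgroups as plain subsets of the ambient type, in the form of the one-step
  subgroup criterion, so that a new instance has only differences to check.\<close>

definition additive_closed :: "'a::ab_group_add set \<Rightarrow> bool" where
  "additive_closed A \<longleftrightarrow> 0 \<in> A \<and> (\<forall>x\<in>A. \<forall>y\<in>A. x - y \<in> A)"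

lemma additive_closed_zero: "additive_closed A \<Longrightarrow> 0 \<in> A"
  by (simp add: additive_closed_def)

lemma additive_closed_diff: "additive_closed A \<Longrightarrow> x \<in> A \<Longrightarrow> y \<in> A \<Longrightarrow> x - y \<in> A"
  by (simp add: additive_closed_def)

lemma additive_closed_uminus: "additive_closed A \<Longrightarrow> x \<in> A \<Longrightarrow> - x \<in> A"
  using additive_closed_diff[of A 0 x] by (simp add: additive_closed_zero)

lemma additive_closed_add: "additive_closed A \<Longrightarrow> x \<in> A \<Longrightarrow> y \<in> A \<Longrightarrow> x + y \<in> A"
  using additive_closed_diff[of A x "- y"] by (simp add: additive_closed_uminus)

lemma additive_closed_of_int_scaleR:
  fixes A :: "'a::real_vector set"
  assumes "additive_closed A" "x \<in> A"
  shows "of_int n *\<^sub>R x \<in> A"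
proof (induction n rule: int_induct[where k = 0])
  case base
  then show ?case using assms by (simp add: additive_closed_zero)
next
  case (step1 i)
  then show ?case using assms by (simp add: additive_closed_add scaleR_add_left)
next
  case (step2 i)
  then show ?case using assms by (simp add: additive_closed_diff scaleR_diff_left)
qed

lemma additive_closed_sum:
  assumes "additive_closed A" "\<And>i. i \<in> I \<Longrightarrow> f i \<in> A"
  shows "sum f I \<in> A"
  using assms(2)
  by (induction I rule: infinite_finite_induct)
    (auto intro: additive_closed_add additive_closed_zero assms(1))

text \<open>Additivity of \<open>f\<close> is known on \<open>A\<close> only, so the induction
  relies on all multiples of \<open>x\<close> staying in \<open>A\<close>. This suits coordinate
  maps obtained by choice, which are arbitrary outside \<open>A\<close>.\<close>

lemma additive_closed_hom_of_int_scaleR: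
  fixes A :: "'a::real_vector set" and f :: "'a \<Rightarrow> int"
  assumes A: "additive_closed A" and x: "x \<in> A"
    and diff: "\<And>x y. x \<in> A \<Longrightarrow> y \<in> A \<Longrightarrow> f (x - y) = f x - f y"
  shows "f (of_int n *\<^sub>R x) = n * f x"
proof -
  have zero: "f 0 = 0"
    using diff[of 0 0] A by (simp add: additive_closed_zero)
  have uminus: "f (- y) = - f y" if "y \<in> A" for y
    using diff[of 0 y] A that zero by (simp add: additive_closed_zero)
  have add: "f (y + z) = f y + f z" if "y \<in> A" "z \<in> A" for y z
    using diff[of y "- z"] A that uminus by (simp add: additive_closed_uminus)
  note mem = additive_closed_of_int_scaleR[OF A x]
  show ?thesis
  proof (induction n rule: int_induct[where k = 0])
    case base
    then show ?case by (simp add: zero)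
  next
    case (step1 i)
    then show ?case by (simp add: scaleR_add_left add mem x algebra_simps)
  next
    case (step2 i)
    then show ?case by (simp add: scaleR_diff_left diff mem x algebra_simps)
  qed
qed

text \<open>Coefficients are indexed by the basis vectors themselves, and their values outside
  \<open>B\<close> do not matter. Unique representation is encoded as the absence of nontrivial
  integer relations.\<close>

definition Z_basis :: "'a::real_vector set \<Rightarrow> 'a set \<Rightarrow> bool" where
  "Z_basis B A \<longleftrightarrow> finite B \<and> B \<subseteq> A \<and>
     (\<forall>x\<in>A. \<exists>c :: 'a \<Rightarrow> int. x = (\<Sum>b\<in>B. of_int (c b) *\<^sub>R b)) \<and>
     (\<forall>c :: 'a \<Rightarrow> int. (\<Sum>b\<in>B. of_int (c b) *\<^sub>R b) = 0 \<longrightarrow> (\<forall>b\<in>B. c b = 0))"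

lemma Z_basis_generates:
  assumes "Z_basis B A" "x \<in> A"
  obtains c :: "'a::real_vector \<Rightarrow> int" where "x = (\<Sum>b\<in>B. of_int (c b) *\<^sub>R b)"
  using assms by (auto simp: Z_basis_def)

lemma Z_basis_independent:
  "Z_basis B A \<Longrightarrow> (\<Sum>b\<in>B. of_int (c b) *\<^sub>R b) = 0 \<Longrightarrow> b \<in> B \<Longrightarrow> c b = (0::int)"
  by (simp add: Z_basis_def)

text \<open>
  Division with remainder in the last coordinate: an element on which that coordinate takes
  a nonzero value of least size completes a basis of the kernel of the coordinate.
\<close>
lemma Z_basis_exists:
  fixes A :: "'a::real_vector set" and \<phi> :: "nat \<Rightarrow> 'a \<Rightarrow> int"
  assumes "additive_closed A"
    and "\<And>i x y. i < k \<Longrightarrow> x \<in> A \<Longrightarrow> y \<in> A \<Longrightarrow> \<phi> i (x - y) = \<phi> i x - \<phi> i y"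
    and "\<And>x. x \<in> A \<Longrightarrow> (\<And>i. i < k \<Longrightarrow> \<phi> i x = 0) \<Longrightarrow> x = 0"
  shows "\<exists>B. Z_basis B A"
  using assms
proof (induction k arbitrary: A)
  case 0
  then have "A = {0}" by (auto simp: additive_closed_zero)
  then have "Z_basis {} A" by (simp add: Z_basis_def)
  then show ?case ..
next
  case (Suc k)
  note A = Suc.prems(1)
  have diff: "\<phi> k (x - y) = \<phi> k x - \<phi> k y" if "x \<in> A" "y \<in> A" for x y
    using Suc.prems(2) that by simp
  have zero: "\<phi> k 0 = 0"
    using diff[of 0 0] A by (simp add: additive_closed_zero)
  define K where "K = {x \<in> A. \<phi> k x = 0}"
  have K: "additive_closed K"
    using A by (auto simp: additive_closed_def K_def diff zero)
  \<comment> \<open>The last coordinate vanishes on the kernel \<open>K\<close>, so there the first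
    \<open>k\<close> coordinates already separate the elements from 0.\<close>
  have "\<exists>B. Z_basis B K"
  proof (rule Suc.IH[OF K])
    show "\<phi> i (x - y) = \<phi> i x - \<phi> i y" if "i < k" "x \<in> K" "y \<in> K" for i x y
      using Suc.prems(2) that by (simp add: K_def)
    show "x = 0" if "x \<in> K" "\<And>i. i < k \<Longrightarrow> \<phi> i x = 0" for x
    proof (rule Suc.prems(3))
      show "x \<in> A" using that(1) by (simp add: K_def)
      show "\<phi> i x = 0" if "i < Suc k" for i
        using \<open>x \<in> K\<close> \<open>\<And>i. i < k \<Longrightarrow> \<phi> i x = 0\<close> that by (auto simp: K_def less_Suc_eq)
    qed
  qed
  then obtain B where B: "Z_basis B K" ..
  show ?case
  proof (cases "K = A")
    case True
    then show ?thesis using B by blast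
  next
    case False
    then obtain x0 where "x0 \<in> A \<and> \<phi> k x0 \<noteq> 0" by (auto simp: K_def)
    \<comment> \<open>The values are compared through \<open>nat\<close> of the absolute value to
      use the well-ordering of the natural numbers.\<close>
    from ex_has_least_nat[of "\<lambda>x. x \<in> A \<and> \<phi> k x \<noteq> 0", OF this, of "\<lambda>x. nat \<bar>\<phi> k x\<bar>"]
    obtain b where b: "b \<in> A" "\<phi> k b \<noteq> 0"
      and least: "\<And>x. x \<in> A \<Longrightarrow> \<phi> k x \<noteq> 0 \<Longrightarrow> \<bar>\<phi> k b\<bar> \<le> \<bar>\<phi> k x\<bar>"
      by force
    have bB: "b \<notin> B" and finB: "finite B" and BK: "B \<subseteq> K"
      using B b by (auto simp: Z_basis_def K_def)
    have mult: "\<phi> k (of_int n *\<^sub>R b) = n * \<phi> k b" for n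
      using A b(1) diff by (rule additive_closed_hom_of_int_scaleR)
    have mem: "of_int n *\<^sub>R b \<in> A" for n
      using A b(1) by (rule additive_closed_of_int_scaleR)
    have "Z_basis (insert b B) A"
      unfolding Z_basis_def
    proof (intro conjI ballI allI impI)
      show "finite (insert b B)" "insert b B \<subseteq> A"
        using finB BK b by (auto simp: K_def)
    next
      fix x assume x: "x \<in> A"
      define q where "q = \<phi> k x div \<phi> k b"
      define y where "y = x - of_int q *\<^sub>R b"
      have yA: "y \<in> A" using A x mem by (simp add: y_def additive_closed_diff)
      have "\<phi> k y = \<phi> k x mod \<phi> k b"
        using diff x mem mult by (simp add: y_def q_def minus_div_mult_eq_mod)
      then have "\<bar>\<phi> k y\<bar> < \<bar>\<phi> k b\<bar>"
        using b(2) by (simp add: abs_mod_less)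
      \<comment> \<open>A nonzero remainder would contradict the minimality of
        \<open>b\<close>.\<close>
      then have "y \<in> K" using least[of y] yA by (force simp: K_def)
      then obtain c :: "'a \<Rightarrow> int" where c: "y = (\<Sum>b\<in>B. of_int (c b) *\<^sub>R b)"
        by (rule Z_basis_generates[OF B])
      have "(\<Sum>a\<in>B. of_int ((c(b := q)) a) *\<^sub>R a) = y"
        unfolding c using bB by (intro sum.cong) auto
      then have "x = (\<Sum>a\<in>insert b B. of_int ((c(b := q)) a) *\<^sub>R a)"
        using bB finB by (simp add: y_def)
      then show "\<exists>c :: 'a \<Rightarrow> int. x = (\<Sum>a\<in>insert b B. of_int (c a) *\<^sub>R a)"
        by (intro exI[of _ "c(b := q)"])
    next
      fix c :: "'a \<Rightarrow> int" and a
      assume c: "(\<Sum>a\<in>insert b B. of_int (c a) *\<^sub>R a) = 0" and a: "a \<in> insert b B"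
      define s where "s = (\<Sum>a\<in>B. of_int (c a) *\<^sub>R a)"
      \<comment> \<open>In a relation the part over \<open>B\<close> is killed by
        \<open>\<phi> k\<close>, hence so is the multiple of \<open>b\<close>. Since
        \<open>\<phi> k b\<close> is nonzero, the coefficient of \<open>b\<close> vanishes and a
        relation over \<open>B\<close> remains.\<close>
      have "s \<in> K" unfolding s_def
        using K BK by (intro additive_closed_sum additive_closed_of_int_scaleR) auto
      moreover have cb: "of_int (c b) *\<^sub>R b = - s"
        using c bB finB by (simp add: s_def eq_neg_iff_add_eq_0)
      ultimately have "of_int (c b) *\<^sub>R b \<in> K"
        using K by (simp add: additive_closed_uminus)
      then have "c b = 0" using mult b(2) by (simp add: K_def)
      moreover from this have "s = 0" using cb by simp
      then have "\<forall>a\<in>B. c a = 0" using Z_basis_independent[OF B] by (simp add: s_def)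
      ultimately show "c a = 0" using a by blast
    qed
    then show ?thesis ..
  qed
qed

section \<open>Sets of reals as modules\<close>

text \<open>Bridge from sums over the carrier of a record to ordinary sums; it lets linear
  combinations be computed in the reals.\<close>

lemma finsum_eq_sum:
  fixes G :: "('b::comm_monoid_add, 'm) ring_scheme"
  assumes "abelian_monoid G" and "ring.add G = (+)" and "ring.zero G = 0"
    and "finite B" and "f \<in> B \<rightarrow> carrier G"
  shows "finsum G f B = sum f B"
proof -
  interpret abelian_monoid G by fact
  show ?thesis
    using assms(4,5) by (induction B rule: finite_induct) (simp_all add: assms(2,3) Pi_iff)
qed

text \<open>Stated for an arbitrary record extension, so that it serves the ring record and both
  kinds of module record.\<close>

lemma abelian_group_real:
  fixes G :: "(real, 'm) ring_scheme"
  assumes "additive_closed (carrier G)" and "ring.add G = (+)" and "ring.zero G = 0"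
  shows "abelian_group G"
proof (rule abelian_groupI)
  fix x assume "x \<in> carrier G"
  then have "- x \<in> carrier G" using assms(1) by (simp add: additive_closed_uminus)
  moreover have "- x \<oplus>\<^bsub>G\<^esub> x = \<zero>\<^bsub>G\<^esub>" by (simp add: assms(2,3))
  ultimately show "\<exists>y\<in>carrier G. y \<oplus>\<^bsub>G\<^esub> x = \<zero>\<^bsub>G\<^esub>" by blast
qed (use assms in \<open>auto simp: additive_closed_add additive_closed_zero\<close>)

lemma abelian_group_real_submodule:
  "additive_closed A \<Longrightarrow> abelian_group (real_submodule A)"
  by (rule abelian_group_real) (simp_all add: real_submodule_def)

lemma abelian_group_real_Z_submodule:
  "additive_closed A \<Longrightarrow> abelian_group (real_Z_submodule A)"
  by (rule abelian_group_real) (simp_all add: real_Z_submodule_def)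

lemma cring_real_subring:
  assumes A: "additive_closed A" and "1 \<in> A" and "\<And>x y. x \<in> A \<Longrightarrow> y \<in> A \<Longrightarrow> x * y \<in> A"
  shows "cring (real_subring A)"
proof (rule cringI)
  show "abelian_group (real_subring A)"
    by (rule abelian_group_real) (use A in \<open>simp_all add: real_subring_def\<close>)
  show "comm_monoid (real_subring A)"
    by (rule comm_monoidI) (use assms in \<open>auto simp: real_subring_def\<close>)
qed (auto simp: real_subring_def algebra_simps)

lemma module_real_submodule:
  assumes "cring (real_subring A)" and "additive_closed S"
    and "\<And>x y. x \<in> A \<Longrightarrow> y \<in> S \<Longrightarrow> x * y \<in> S"
  shows "Module.module (real_subring A) (real_submodule S)"
  by (rule Module.moduleI[OF assms(1) abelian_group_real_submodule[OF assms(2)]])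
    (use assms(3) in \<open>auto simp: real_subring_def real_submodule_def algebra_simps\<close>)

lemma module_real_Z_submodule:
  assumes "additive_closed S"
  shows "Module.module int_ring (real_Z_submodule S)"
  by (rule Module.moduleI[OF int_is_cring abelian_group_real_Z_submodule[OF assms]])
    (use additive_closed_of_int_scaleR[OF assms] in
      \<open>auto simp: real_Z_submodule_def algebra_simps\<close>)

section \<open>Linear combinations, bases and generators in modules of reals\<close>

lemma lincomb_real_submodule:
  assumes "additive_closed S" and "finite B" and "\<And>b. b \<in> B \<Longrightarrow> c b * b \<in> S"
  shows "lincomb (real_submodule S) c B = (\<Sum>b\<in>B. c b * b)"
  unfolding lincomb_def
  by (subst finsum_eq_sum)
    (use assms abelian_group_real_submodule[OF assms(1)] in
      \<open>auto simp: real_submodule_def abelian_group_def\<close>)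

lemma lincomb_real_Z_submodule:
  assumes "additive_closed S" and "finite B" and "B \<subseteq> S"
  shows "lincomb (real_Z_submodule S) c B = (\<Sum>b\<in>B. of_int (c b) * b)"
  unfolding lincomb_def
  by (subst finsum_eq_sum)
    (use assms abelian_group_real_Z_submodule[OF assms(1)]
        additive_closed_of_int_scaleR[OF assms(1)] in
      \<open>auto simp: real_Z_submodule_def abelian_group_def\<close>)

text \<open>Existence of coefficients is generation by \<open>B\<close>; uniqueness is independence
  applied to the difference of two families. Restricting to \<open>B\<close> provides the
  extensional representative.\<close>

lemma free_real_Z_submodule:
  assumes S: "additive_closed S" and "Z_basis B S"
  shows "free_module_of_rank int_ring (real_Z_submodule S) (card B)"
proof -
  have B: "finite B" "B \<subseteq> S"
    using assms(2) by (auto simp: Z_basis_def)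
  note lin = lincomb_real_Z_submodule[OF S B]
  have "\<exists>!c. c \<in> B \<rightarrow>\<^sub>E (UNIV :: int set) \<and> x = lincomb (real_Z_submodule S) c B"
    if x: "x \<in> S" for x
  proof -
    obtain c :: "real \<Rightarrow> int" where c: "x = (\<Sum>b\<in>B. of_int (c b) * b)"
      using Z_basis_generates[OF assms(2) x] by auto
    show ?thesis
    proof (rule ex1I[of _ "restrict c B"])
      show "restrict c B \<in> B \<rightarrow>\<^sub>E UNIV \<and> x = lincomb (real_Z_submodule S) (restrict c B) B"
        by (simp add: lin c)
    next
      fix d assume d: "d \<in> B \<rightarrow>\<^sub>E UNIV \<and> x = lincomb (real_Z_submodule S) d B"
      then have "(\<Sum>b\<in>B. of_int (d b - c b) * b) = 0"
        using c by (simp add: lin algebra_simps sum_subtractf)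
      then have "d b - c b = 0" if "b \<in> B" for b
        using Z_basis_independent[OF assms(2) _ that, of "\<lambda>b. d b - c b"] by simp
      then show "d = restrict c B"
        using d by (intro extensionalityI[of _ B]) (auto simp: PiE_def)
    qed
  qed
  then show ?thesis
    unfolding free_module_of_rank_def
    using B module_real_Z_submodule[OF S]
    by (intro conjI exI[of _ B]) (auto simp: real_Z_submodule_def)
qed

text \<open>Since 1 lies in \<open>A\<close>, so do all integers, and an integral basis of
  \<open>S\<close> generates it over \<open>A\<close> as well.\<close>

lemma finitely_generated_real_submodule:
  assumes A: "cring (real_subring A)" "additive_closed A" "1 \<in> A"
    and S: "additive_closed S" and AS: "\<And>x y. x \<in> A \<Longrightarrow> y \<in> S \<Longrightarrow> x * y \<in> S"
    and "Z_basis B S"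
  shows "finitely_generated_module (real_subring A) (real_submodule S)"
proof -
  have B: "finite B" "B \<subseteq> S"
    using assms(6) by (auto simp: Z_basis_def)
  have int: "of_int n \<in> A" for n
    using additive_closed_of_int_scaleR[OF A(2,3), of n] by simp
  have "\<exists>c \<in> B \<rightarrow>\<^sub>E A. x = lincomb (real_submodule S) c B" if x: "x \<in> S" for x
  proof -
    obtain c :: "real \<Rightarrow> int" where c: "x = (\<Sum>b\<in>B. of_int (c b) * b)"
      using Z_basis_generates[OF assms(6) x] by auto
    define d where "d = restrict (\<lambda>b. real_of_int (c b)) B"
    have "d \<in> B \<rightarrow>\<^sub>E A" using int by (auto simp: d_def)
    moreover have "lincomb (real_submodule S) d B = x"
      by (subst lincomb_real_submodule[OF S B(1)]) (use AS int B in \<open>auto simp: d_def c\<close>)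
    ultimately show ?thesis by blast
  qed
  then show ?thesis
    unfolding finitely_generated_module_def
    using B module_real_submodule[OF A(1) S AS]
    by (intro conjI exI[of _ B]) (auto simp: real_submodule_def real_subring_def)
qed

text \<open>The basis is the singleton of \<alpha>; uniqueness of the coefficient is cancellation of
  the nonzero real \<alpha>.\<close>

lemma free_real_submodule_rank_1:
  assumes A: "cring (real_subring A)" and S: "additive_closed S"
    and gen: "S = (\<lambda>\<beta>. \<alpha> * \<beta>) ` A" and \<alpha>: "\<alpha> \<in> S" "\<alpha> \<noteq> 0"
  shows "free_module_of_rank (real_subring A) (real_submodule S) 1"
proof -
  interpret cring "real_subring A" by fact
  have AA: "x * y \<in> A" if "x \<in> A" "y \<in> A" for x y
    using m_closed that by (simp add: real_subring_def)
  have AS: "x * y \<in> S" if "x \<in> A" "y \<in> S" for x y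
    using AA that by (force simp: gen)
  have lin: "lincomb (real_submodule S) c {\<alpha>} = c \<alpha> * \<alpha>" if "c \<in> {\<alpha>} \<rightarrow>\<^sub>E A" for c
    by (subst lincomb_real_submodule[OF S]) (use AS \<alpha> that in auto)
  have "\<exists>!c. c \<in> {\<alpha>} \<rightarrow>\<^sub>E A \<and> x = lincomb (real_submodule S) c {\<alpha>}" if x: "x \<in> S" for x
  proof -
    obtain a where a: "a \<in> A" "x = \<alpha> * a" using x by (auto simp: gen)
    show ?thesis
    proof (rule ex1I[of _ "restrict (\<lambda>_. a) {\<alpha>}"])
      have "restrict (\<lambda>_. a) {\<alpha>} \<in> {\<alpha>} \<rightarrow>\<^sub>E A" using a by auto
      then show "restrict (\<lambda>_. a) {\<alpha>} \<in> {\<alpha>} \<rightarrow>\<^sub>E A \<and>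
          x = lincomb (real_submodule S) (restrict (\<lambda>_. a) {\<alpha>}) {\<alpha>}"
        by (simp add: lin a)
    next
      fix d assume d: "d \<in> {\<alpha>} \<rightarrow>\<^sub>E A \<and> x = lincomb (real_submodule S) d {\<alpha>}"
      then have "d \<alpha> = a" using lin[of d] a \<alpha> by simp
      then show "d = restrict (\<lambda>_. a) {\<alpha>}"
        using d by (intro extensionalityI[of _ "{\<alpha>}"]) (auto simp: PiE_def)
    qed
  qed
  then show ?thesis
    unfolding free_module_of_rank_def
    using \<alpha> module_real_submodule[OF A S AS]
    by (intro conjI exI[of _ "{\<alpha>}"]) (auto simp: real_submodule_def real_subring_def)
qed

text \<open>Translates an ideal given by ordinary real arithmetic into one of the ring record, where
  the principal ideal property supplies a generator.\<close>

lemma principal_domain_real_subring_ideal: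
  assumes pid: "principal_domain (real_subring A)"
    and I: "additive_closed I" "I \<subseteq> A" and IA: "\<And>a x. a \<in> I \<Longrightarrow> x \<in> A \<Longrightarrow> x * a \<in> I"
  shows "\<exists>g\<in>A. I = (\<lambda>x. x * g) ` A"
proof -
  interpret principal_domain "real_subring A" by fact
  have "subgroup I (add_monoid (real_subring A))"
  proof
    fix x assume x: "x \<in> I"
    \<comment> \<open>The inverse in the record is abstract; uniqueness of additive inverses
      identifies it with the real negative.\<close>
    then have "\<ominus>\<^bsub>real_subring A\<^esub> x = - x"
      using I by (intro minus_equality)
        (auto simp: real_subring_def additive_closed_uminus subset_iff)
    then show "inv\<^bsub>add_monoid (real_subring A)\<^esub> x \<in> I"
      using I x by (simp add: a_inv_def additive_closed_uminus)
  qed (use I in \<open>auto simp: real_subring_def additive_closed_add additive_closed_zero\<close>)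
  then have "ideal I (real_subring A)"
    using IA by (intro idealI ring_axioms) (auto simp: real_subring_def mult.commute)
  from exists_gen[OF this] show ?thesis
    by (auto simp: cgenideal_def real_subring_def)
qed

section \<open>Rational independence\<close>

text \<open>By induction: a common denominator for the rest is multiplied by a denominator of the
  new element.\<close>

lemma finite_rat_common_denominator:
  assumes "finite (F :: rat set)"
  shows "\<exists>m > (0::int). \<forall>q\<in>F. of_int m * q \<in> \<int>"
  using assms
proof (induction F)
  case empty
  show ?case by (auto intro: exI[of _ 1])
next
  case (insert a F)
  then obtain m :: int where m: "m > 0" "\<And>q. q \<in> F \<Longrightarrow> of_int m * q \<in> \<int>" by blast
  obtain p n where pn: "n > 0" "a = of_int p / of_int n"
    using quotient_of_div[of a] quotient_of_denom_pos[of a] by (metis surj_pair)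
  have "of_int (m * n) * q \<in> \<int>" if "q \<in> insert a F" for q :: rat
  proof (cases "q = a")
    case True
    then have "of_int (m * n) * q = of_int (m * p)" using pn by simp
    then show ?thesis by (simp only: Ints_of_int)
  next
    case False
    then have "of_int n * (of_int m * q) \<in> \<int>"
      using Ints_mult[OF Ints_of_int m(2)] that False by blast
    then show ?thesis by (simp only: of_int_mult ac_simps)
  qed
  then show ?case using m pn by (intro exI[of _ "m * n"]) auto
qed

text \<open>This and \<open>Z_span\<close> are the first and last conditions of
  \<open>free_Z_module\<close>, taken over any real vector space. Only rational relations are
  excluded, so the family may be dependent over the reals.\<close>

definition Q_independent :: "nat \<Rightarrow> (nat \<Rightarrow> 'a::real_vector) \<Rightarrow> bool" where
  "Q_independent k t \<longleftrightarrow>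
     (\<forall>q :: nat \<Rightarrow> rat. (\<Sum>i<k. of_rat (q i) *\<^sub>R t i) = 0 \<longrightarrow> (\<forall>i<k. q i = 0))"

definition Z_span :: "nat \<Rightarrow> (nat \<Rightarrow> 'a::real_vector) \<Rightarrow> 'a set" where
  "Z_span k t = range (\<lambda>c :: nat \<Rightarrow> int. \<Sum>i<k. of_int (c i) *\<^sub>R t i)"

lemma additive_closed_Z_span: "additive_closed (Z_span k t)"
  unfolding additive_closed_def
proof (intro conjI ballI)
  show "0 \<in> Z_span k t"
    unfolding Z_span_def by (rule range_eqI[of _ _ "\<lambda>_. 0"]) simp
next
  fix x y assume "x \<in> Z_span k t" "y \<in> Z_span k t"
  then obtain c d :: "nat \<Rightarrow> int"
    where "x = (\<Sum>i<k. of_int (c i) *\<^sub>R t i)" "y = (\<Sum>i<k. of_int (d i) *\<^sub>R t i)"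
    by (auto simp: Z_span_def)
  then show "x - y \<in> Z_span k t"
    unfolding Z_span_def
    by (intro range_eqI[of _ _ "\<lambda>i. c i - d i"]) (simp add: sum_subtractf scaleR_diff_left)
qed

lemma Z_span_generator:
  assumes "i < k"
  shows "t i \<in> Z_span k t"
proof -
  have "(\<Sum>j<k. of_int (if j = i then 1 else 0) *\<^sub>R t j) = (\<Sum>j<k. if j = i then t j else 0)"
    by (intro sum.cong) auto
  then have "t i = (\<Sum>j<k. of_int (if j = i then 1 else 0) *\<^sub>R t j)"
    using assms by simp
  then show ?thesis
    unfolding Z_span_def by (rule range_eqI[of _ _ "\<lambda>j. if j = i then 1 else 0"])
qed

lemma Q_independent_Z:
  assumes "Q_independent k t" "(\<Sum>i<k. of_int (c i) *\<^sub>R t i) = 0" "i < k"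
  shows "c i = (0::int)"
  using assms(1)[unfolded Q_independent_def, rule_format, of "\<lambda>i. of_int (c i)"] assms(2,3)
  by simp

lemma Q_independent_inj_on:
  assumes "Q_independent k t"
  shows "inj_on t {..<k}"
proof
  fix i j assume ij: "i \<in> {..<k}" "j \<in> {..<k}" "t i = t j"
  show "i = j"
  proof (rule ccontr)
    assume ne: "i \<noteq> j"
    \<comment> \<open>If \<open>t i = t j\<close>, the coefficients 1 at \<open>i\<close> and -1 at
      \<open>j\<close> form a nontrivial relation.\<close>
    let ?c = "\<lambda>l. (if l = i then 1 else 0) - (if l = j then 1 else 0) :: int"
    have "(\<Sum>l<k. of_int (?c l) *\<^sub>R t l) =
        (\<Sum>l<k. (if l = i then t l else 0) - (if l = j then t l else 0))"
      by (intro sum.cong) auto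
    also have "\<dots> = 0" using ij by (simp add: sum_subtractf)
    finally have "?c i = 0" using ij(1) by (intro Q_independent_Z[OF assms]) auto
    then show False using ne by simp
  qed
qed

text \<open>Restriction of scalars to the rationals, which makes the exchange lemma available for
  rational independence.\<close>

interpretation Q: vector_space "\<lambda>(q::rat) (x::'a::real_vector). of_rat q *\<^sub>R x"
  by unfold_locales (simp_all add: algebra_simps of_rat_add of_rat_mult)

lemma Q_independent_imp_independent:
  assumes "Q_independent k t"
  shows "Q.independent (t ` {..<k})"
proof (rule Q.independent_if_scalars_zero)
  fix f x assume sum: "(\<Sum>x\<in>t ` {..<k}. of_rat (f x) *\<^sub>R x) = 0" and x: "x \<in> t ` {..<k}"
  then have "(\<Sum>i<k. of_rat (f (t i)) *\<^sub>R t i) = 0"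
    by (simp add: sum.reindex[OF Q_independent_inj_on[OF assms]])
  then show "f x = 0" using assms x by (auto simp: Q_independent_def)
qed simp

text \<open>
  By the exchange lemma the \<open>k\<close> independent vectors \<open>u i\<close> span the same rational space as
  the \<open>t i\<close>; clearing denominators gives the multiple.
\<close>
lemma Z_span_multiple:
  fixes t u :: "nat \<Rightarrow> 'a::real_vector"
  assumes t: "Q_independent k t" and u: "Q_independent k u"
    and ut: "\<And>i. i < k \<Longrightarrow> u i \<in> Z_span k t"
  shows "\<exists>m > (0::int). \<forall>x \<in> Z_span k t. of_int m *\<^sub>R x \<in> Z_span k u"
proof -
  note iu = Q_independent_imp_independent[OF u]
  have sub: "u ` {..<k} \<subseteq> Q.span (t ` {..<k})"
  proof
    fix x assume "x \<in> u ` {..<k}"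
    then have "x \<in> Z_span k t" using ut by auto
    then obtain c :: "nat \<Rightarrow> int" where x: "x = (\<Sum>i<k. of_int (c i) *\<^sub>R t i)"
      by (auto simp: Z_span_def)
    have "(\<Sum>i<k. of_rat (of_int (c i)) *\<^sub>R t i) \<in> Q.span (t ` {..<k})"
      by (intro Q.span_sum Q.span_scale Q.span_base) auto
    then show "x \<in> Q.span (t ` {..<k})" by (simp add: x)
  qed
  have "t j \<in> Q.span (u ` {..<k})" if j: "j < k" for j
  proof (rule ccontr)
    assume not: "t j \<notin> Q.span (u ` {..<k})"
    then have "Q.independent (insert (t j) (u ` {..<k}))"
      by (rule Q.independent_insertI[OF _ iu])
    moreover have "insert (t j) (u ` {..<k}) \<subseteq> Q.span (t ` {..<k})"
      using sub Q.span_base[of "t j" "t ` {..<k}"] j by simp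
    ultimately have "card (insert (t j) (u ` {..<k})) \<le> card (t ` {..<k})"
      by (rule conjunct2[OF Q.independent_span_bound[OF finite_imageI[OF finite_lessThan]]])
    moreover have "t j \<notin> u ` {..<k}" using not Q.span_base[of "t j" "u ` {..<k}"] by metis
    ultimately show False
      using Q_independent_inj_on[OF t] Q_independent_inj_on[OF u] by (simp add: card_image)
  qed
  moreover have "\<exists>q. x = (\<Sum>i<k. of_rat (q i) *\<^sub>R u i)"
    if x: "x \<in> Q.span (u ` {..<k})" for x
  proof -
    obtain f where "x = (\<Sum>v\<in>u ` {..<k}. of_rat (f v) *\<^sub>R v)"
      using x unfolding Q.span_finite[OF finite_imageI[OF finite_lessThan]] by (rule rangeE)
    then have "x = (\<Sum>i<k. of_rat (f (u i)) *\<^sub>R u i)"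
      by (simp add: sum.reindex[OF Q_independent_inj_on[OF u]])
    then show ?thesis by (intro exI[of _ "\<lambda>i. f (u i)"])
  qed
  ultimately have "\<forall>j\<in>{..<k}. \<exists>q. t j = (\<Sum>i<k. of_rat (q i) *\<^sub>R u i)" by simp
  from bchoice[OF this] obtain q
    where q: "\<And>j. j < k \<Longrightarrow> t j = (\<Sum>i<k. of_rat (q j i) *\<^sub>R u i)" by auto
  \<comment> \<open>One common denominator for all \<open>k * k\<close> entries of the matrix
    expressing the \<open>t j\<close> in the \<open>u i\<close>.\<close>
  obtain m :: int where m: "m > 0"
    and qm: "\<And>i j. i < k \<Longrightarrow> j < k \<Longrightarrow> of_int m * q j i \<in> \<int>"
    using finite_rat_common_denominator[of "(\<lambda>(j, i). q j i) ` ({..<k} \<times> {..<k})"]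
    by (auto simp: ball_simps)
  have tm: "of_int m *\<^sub>R t j \<in> Z_span k u" if j: "j < k" for j
  proof -
    \<comment> \<open>The floor is exact here, since its argument is an integer; it only converts
      that rational to type \<open>int\<close>.\<close>
    have "of_int m *\<^sub>R t j = (\<Sum>i<k. of_int \<lfloor>of_int m * q j i\<rfloor> *\<^sub>R u i)"
      unfolding q[OF j] scaleR_sum_right
    proof (rule sum.cong)
      fix i assume "i \<in> {..<k}"
      then obtain n where n: "of_int m * q j i = of_int n"
        using qm[of i j] j by (auto elim: Ints_cases)
      have "of_int m * real_of_rat (q j i) = of_rat (of_int m * q j i)"
        by (simp add: of_rat_mult)
      also have "\<dots> = of_int n" by (simp add: n)
      finally have "of_int m * real_of_rat (q j i) = of_int n" .
      then show "of_int m *\<^sub>R of_rat (q j i) *\<^sub>R u i = of_int \<lfloor>of_int m * q j i\<rfloor> *\<^sub>R u i"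
        by (simp add: n)
    qed simp
    then show ?thesis
      unfolding Z_span_def by (rule range_eqI[of _ _ "\<lambda>i. \<lfloor>of_int m * q j i\<rfloor>"])
  qed
  have "of_int m *\<^sub>R x \<in> Z_span k u" if x: "x \<in> Z_span k t" for x
  proof -
    obtain c :: "nat \<Rightarrow> int" where x: "x = (\<Sum>i<k. of_int (c i) *\<^sub>R t i)"
      using x by (auto simp: Z_span_def)
    have "(\<Sum>i<k. of_int (c i) *\<^sub>R of_int m *\<^sub>R t i) \<in> Z_span k u"
      by (intro additive_closed_sum[OF additive_closed_Z_span]
          additive_closed_of_int_scaleR[OF additive_closed_Z_span tm]) simp
    then show ?thesis by (simp add: x scaleR_sum_right mult.commute)
  qed
  then show ?thesis using m by blast
qed

section \<open>The scaling sets\<close>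

lemma ScalD: "\<alpha> \<in> Scal M R \<Longrightarrow> x \<in> M \<Longrightarrow> \<alpha> *\<^sub>R (R *v x) \<in> M"
  by (auto simp: Scal_def)

lemma ScalI: "(\<And>x. x \<in> M \<Longrightarrow> \<alpha> *\<^sub>R (R *v x) \<in> M) \<Longrightarrow> \<alpha> \<in> Scal M R"
  by (auto simp: Scal_def)

lemma additive_closed_Scal:
  assumes "additive_closed M"
  shows "additive_closed (Scal M R)"
  unfolding additive_closed_def[of "Scal M R"]
proof (intro conjI ballI ScalI)
  show "0 *\<^sub>R (R *v x) \<in> M" for x
    using assms by (simp add: additive_closed_zero)
  show "(\<alpha> - \<beta>) *\<^sub>R (R *v x) \<in> M" if "\<alpha> \<in> Scal M R" "\<beta> \<in> Scal M R" "x \<in> M" for \<alpha> \<beta> x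
    using additive_closed_diff[OF assms ScalD ScalD, OF that(1,3,2,3)]
    by (simp add: scaleR_diff_left)
qed

text \<open>Used in two ways: with the identity as \<open>R\<close> it gives the action of the
  scaling ring, and with a left inverse of \<open>T\<close> as \<open>R\<close> it sends
  \<open>Scal M T\<close> into that ring.\<close>

lemma Scal_mult:
  assumes "\<alpha> \<in> Scal M R" "\<beta> \<in> Scal M T"
  shows "\<alpha> * \<beta> \<in> Scal M (R ** T)"
proof (rule ScalI)
  fix x assume "x \<in> M"
  then have "\<alpha> *\<^sub>R (R *v (\<beta> *\<^sub>R (T *v x))) \<in> M"
    using assms by (intro ScalD)
  then show "(\<alpha> * \<beta>) *\<^sub>R ((R ** T) *v x) \<in> M"
    by (simp add: matrix_vector_mult_scaleR matrix_vector_mul_assoc)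
qed

section \<open>Integral bases and principal generators of the scaling sets\<close>

lemma invertible_mult_eq_zero:
  fixes R :: "real ^ 'n ^ 'n"
  assumes "invertible R" "R *v x = 0"
  shows "x = 0"
  using injD[OF inj_matrix_vector_mult[OF assms(1)], of x 0] assms(2) by simp

text \<open>The coordinates of \<open>\<alpha> *\<^sub>R (R *v t 0)\<close> serve as the separating
  maps of \<open>Z_basis_exists\<close>. They are picked by choice; independence of \<open>t\<close>
  makes them additive in \<alpha>, and they all vanish only for \<alpha> = 0 because
  \<open>R *v t 0\<close> is nonzero.\<close>

lemma Z_basis_Scal_exists:
  fixes R :: "real ^ 'd ^ 'd"
  assumes t: "Q_independent k t" and k: "k > 0" and R: "invertible R"
  shows "\<exists>B. Z_basis B (Scal (Z_span k t) R)"
proof -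
  let ?S = "Scal (Z_span k t) R"
  have S: "additive_closed ?S" by (intro additive_closed_Scal additive_closed_Z_span)
  have "t 0 \<noteq> 0"
  proof
    assume "t 0 = 0"
    then have "(\<Sum>i<k. of_int (if i = 0 then 1 else 0) *\<^sub>R t i) = 0"
      by (intro sum.neutral) auto
    from Q_independent_Z[OF t this k] show False by simp
  qed
  then have Rt: "R *v t 0 \<noteq> 0" using invertible_mult_eq_zero[OF R] by blast
  have "\<forall>\<alpha>\<in>?S. \<exists>c :: nat \<Rightarrow> int. \<alpha> *\<^sub>R (R *v t 0) = (\<Sum>i<k. of_int (c i) *\<^sub>R t i)"
  proof
    fix \<alpha> assume "\<alpha> \<in> ?S"
    from ScalD[OF this Z_span_generator[OF k]]
    show "\<exists>c :: nat \<Rightarrow> int. \<alpha> *\<^sub>R (R *v t 0) = (\<Sum>i<k. of_int (c i) *\<^sub>R t i)"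
      unfolding Z_span_def by (rule rangeE) (rule exI)
  qed
  from bchoice[OF this] obtain c :: "real \<Rightarrow> nat \<Rightarrow> int"
    where c: "\<And>\<alpha>. \<alpha> \<in> ?S \<Longrightarrow> \<alpha> *\<^sub>R (R *v t 0) = (\<Sum>i<k. of_int (c \<alpha> i) *\<^sub>R t i)"
    by auto
  show ?thesis
  proof (rule Z_basis_exists[OF S, of k "\<lambda>i \<alpha>. c \<alpha> i"])
    fix i \<alpha> \<beta> assume i: "i < k" and \<alpha>: "\<alpha> \<in> ?S" and \<beta>: "\<beta> \<in> ?S"
    have "(\<Sum>i<k. of_int (c (\<alpha> - \<beta>) i - (c \<alpha> i - c \<beta> i)) *\<^sub>R t i) = 0"
      using c[OF \<alpha>] c[OF \<beta>] c[OF additive_closed_diff[OF S \<alpha> \<beta>]]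
      by (simp add: scaleR_diff_left sum_subtractf)
    from Q_independent_Z[OF t this i] show "c (\<alpha> - \<beta>) i = c \<alpha> i - c \<beta> i" by simp
  next
    fix \<alpha> assume "\<alpha> \<in> ?S" "\<And>i. i < k \<Longrightarrow> c \<alpha> i = 0"
    then show "\<alpha> = 0" using c[of \<alpha>] Rt by simp
  qed
qed

lemma Scal_generator:
  fixes R :: "real ^ 'd ^ 'd"
  assumes t: "Q_independent k t" and R: "invertible R"
    and M: "M = Z_span k t"
    and pid: "principal_domain (real_subring (Scal M (mat 1)))"
  shows "\<exists>\<alpha> \<in> Scal M R. Scal M R = (\<lambda>\<beta>. \<alpha> * \<beta>) ` Scal M (mat 1)"
proof (cases "Scal M R = {0}")
  \<comment> \<open>No nonzero scaling to divide by exists here, and 0 itself is the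
    generator.\<close>
  case True
  moreover have "0 \<in> Scal M (mat 1)"
    by (simp add: M additive_closed_zero additive_closed_Scal additive_closed_Z_span)
  ultimately show ?thesis by force
next
  case False
  let ?A = "Scal M (mat 1)" and ?S = "Scal M R"
  have clM: "additive_closed M" by (simp add: M additive_closed_Z_span)
  have clS: "additive_closed ?S" using clM by (simp add: additive_closed_Scal)
  obtain \<gamma> where \<gamma>: "\<gamma> \<in> ?S" "\<gamma> \<noteq> 0"
    using False additive_closed_zero[OF clS] by blast
  \<comment> \<open>The images of the \<open>t i\<close> under the injective map \<gamma> R, so that
    \<open>Z_span k u\<close> is the submodule \<gamma> R M.\<close>
  define u where "u i = \<gamma> *\<^sub>R (R *v t i)" for i
  have image: "(\<Sum>i<k. f i *\<^sub>R u i) = \<gamma> *\<^sub>R (R *v (\<Sum>i<k. f i *\<^sub>R t i))" for f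
    by (simp add: u_def scaleR_sum_right matrix_vector_mult_scaleR
        linear_sum[OF matrix_vector_mul_linear] mult.commute)
  have u: "Q_independent k u"
    using t \<gamma>(2) by (auto simp: Q_independent_def image dest: invertible_mult_eq_zero[OF R])
  have uM: "u i \<in> Z_span k t" if "i < k" for i
    using ScalD[OF \<gamma>(1)] Z_span_generator[OF that, of t] by (simp add: u_def M)
  obtain m :: int where m: "m > 0" and mM: "\<And>x. x \<in> M \<Longrightarrow> of_int m *\<^sub>R x \<in> Z_span k u"
    using Z_span_multiple[OF t u uM] M by blast
  define \<delta> where "\<delta> = of_int m / \<gamma>"
  have \<delta>: "\<delta> \<noteq> 0" using m \<gamma> by (simp add: \<delta>_def)
  obtain R' where inv: "R' ** R = mat 1"
    using R by (auto simp: invertible_def)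
  have \<delta>_inv: "\<delta> \<in> Scal M (R')"
  proof (rule ScalI)
    fix x assume "x \<in> M"
    from mM[OF this] obtain c :: "nat \<Rightarrow> int"
      where c: "of_int m *\<^sub>R x = (\<Sum>i<k. of_int (c i) *\<^sub>R u i)"
      by (auto simp: Z_span_def)
    let ?y = "\<Sum>i<k. of_int (c i) *\<^sub>R t i"
    \<comment> \<open>With m x = \<gamma> R y for y in M, division by \<gamma> gives \<delta> x = R
      y, and \<open>R'\<close> recovers y.\<close>
    have "\<delta> *\<^sub>R x = (1 / \<gamma>) *\<^sub>R of_int m *\<^sub>R x" by (simp add: \<delta>_def)
    also have "\<dots> = R *v ?y" unfolding c image using \<gamma>(2) by simp
    finally have "R' *v (\<delta> *\<^sub>R x) = ?y"
      by (simp add: matrix_vector_mul_assoc inv)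
    then have "\<delta> *\<^sub>R (R' *v x) = ?y" by (simp add: matrix_vector_mult_scaleR)
    then show "\<delta> *\<^sub>R (R' *v x) \<in> M" by (auto simp: M Z_span_def)
  qed
  have AS: "x * y \<in> ?S" if "x \<in> ?A" "y \<in> ?S" for x y
    using Scal_mult[OF that] by simp
  have "\<exists>g\<in>?A. (\<lambda>x. \<delta> * x) ` ?S = (\<lambda>x. x * g) ` ?A"
  proof (rule principal_domain_real_subring_ideal[OF pid])
    show "additive_closed ((\<lambda>x. \<delta> * x) ` ?S)"
      using clS by (auto simp: additive_closed_def image_iff simp flip: right_diff_distrib)
    show "(\<lambda>x. \<delta> * x) ` ?S \<subseteq> ?A"
      using Scal_mult[OF \<delta>_inv, of _ R] by (auto simp: inv)
    show "x * a \<in> (\<lambda>x. \<delta> * x) ` ?S" if "a \<in> (\<lambda>x. \<delta> * x) ` ?S" "x \<in> ?A" for a x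
      using that AS by (auto simp: image_iff)
  qed
  then obtain g where g: "g \<in> ?A" "(\<lambda>x. \<delta> * x) ` ?S = (\<lambda>x. x * g) ` ?A" by blast
  \<comment> \<open>Undoing the multiplication by \<delta> carries the generator \<open>g\<close> of
    the ideal to \<open>g / \<delta>\<close>.\<close>
  have "?S = (\<lambda>x. x / \<delta>) ` (\<lambda>x. \<delta> * x) ` ?S"
    using \<delta> by (simp add: image_image)
  also have "\<dots> = (\<lambda>\<beta>. (g / \<delta>) * \<beta>) ` ?A"
    unfolding g(2) image_image by (simp add: mult.commute)
  finally have S: "?S = (\<lambda>\<beta>. (g / \<delta>) * \<beta>) ` ?A" .
  have "1 \<in> ?A" by (rule ScalI) simp
  \<comment> \<open>Take the factor 1 of the scaling ring in the description of
    \<open>?S\<close>.\<close>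
  then have "g / \<delta> \<in> ?S" by (subst S) force
  then show ?thesis using S by blast
qed

text \<open>Freeness of rank 1 is claimed for a nonzero scaling set: in the zero module the
  coefficients 0 and 1 of a single basis element give the same vector. The generator \<alpha> exists
  in either case.\<close>

theorem theorem15:
  fixes M :: "(real ^ 'd) set" and R :: "real ^ 'd ^ 'd"
  assumes "free_Z_module M"
    and "orthogonal_matrix R"
  shows "(\<exists>n. free_module_of_rank int_ring (real_Z_submodule (Scal M R)) n) \<and>
     (\<forall>\<beta> \<in> Scal M (mat 1). (\<lambda>\<alpha>. \<beta> * \<alpha>) ` Scal M R \<subseteq> Scal M R) \<and>
     finitely_generated_module (real_subring (Scal M (mat 1))) (real_submodule (Scal M R)) \<and>
     (principal_domain (real_subring (Scal M (mat 1))) \<longrightarrow>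
        (\<exists>\<alpha> \<in> Scal M R. Scal M R = (\<lambda>\<beta>. \<alpha> * \<beta>) ` Scal M (mat 1)) \<and>
        (Scal M R \<noteq> {0} \<longrightarrow>
           free_module_of_rank (real_subring (Scal M (mat 1))) (real_submodule (Scal M R)) 1))"
proof -
  let ?A = "Scal M (mat 1)" and ?S = "Scal M R"
  obtain k :: nat and t :: "nat \<Rightarrow> real ^ 'd"
    where t: "Q_independent k t" and span: "span (t ` {..<k}) = UNIV" and M: "M = Z_span k t"
    using assms(1) unfolding free_Z_module_def Q_independent_def Z_span_def by blast
  \<comment> \<open>Without generators the real span would be zero, but a standard unit vector is
    nonzero; \<open>undefined\<close> is just some index.\<close>
  have "k > 0"
  proof (rule ccontr)
    assume "\<not> k > 0"
    then have "(UNIV :: (real ^ 'd) set) = {0}" using span by simp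
    then have "axis undefined 1 = (0 :: real ^ 'd)" by blast
    then show False by simp
  qed
  have R: "invertible R"
    using assms(2) by (auto simp: invertible_def orthogonal_matrix_def)
  have clM: "additive_closed M" by (simp add: M additive_closed_Z_span)
  have clS: "additive_closed ?S" and clA: "additive_closed ?A"
    using clM by (simp_all add: additive_closed_Scal)
  have one: "1 \<in> ?A" by (rule ScalI) simp
  have AS: "x * y \<in> ?S" if "x \<in> ?A" "y \<in> ?S" for x y
    using Scal_mult[OF that] by simp
  have AA: "x * y \<in> ?A" if "x \<in> ?A" "y \<in> ?A" for x y
    using Scal_mult[OF that] by simp
  have A: "cring (real_subring ?A)"
    by (rule cring_real_subring[OF clA one AA])
  obtain B where B: "Z_basis B ?S"
    using Z_basis_Scal_exists[OF t \<open>k > 0\<close> R] M by blast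
  show ?thesis
  proof (intro conjI impI)
    show "\<exists>n. free_module_of_rank int_ring (real_Z_submodule ?S) n"
      using free_real_Z_submodule[OF clS B] ..
    show "\<forall>\<beta>\<in>?A. (\<lambda>\<alpha>. \<beta> * \<alpha>) ` ?S \<subseteq> ?S" using AS by blast
    show "finitely_generated_module (real_subring ?A) (real_submodule ?S)"
      by (rule finitely_generated_real_submodule[OF A clA one clS AS B])
  next
    assume pid: "principal_domain (real_subring ?A)"
    show "\<exists>\<alpha>\<in>?S. ?S = (\<lambda>\<beta>. \<alpha> * \<beta>) ` ?A"
      by (rule Scal_generator[OF t R M pid])
    then obtain \<alpha> where \<alpha>: "\<alpha> \<in> ?S" "?S = (\<lambda>\<beta>. \<alpha> * \<beta>) ` ?A" by blast
    assume "?S \<noteq> {0}"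
    \<comment> \<open>For \<alpha> = 0 the image of the nonempty set \<open>?A\<close> would be the
      zero set.\<close>
    then have "\<alpha> \<noteq> 0" using \<alpha> one by (auto simp: image_iff)
    then show "free_module_of_rank (real_subring ?A) (real_submodule ?S) 1"
      by (rule free_real_submodule_rank_1[OF A clS \<alpha>(2,1)])
  qed
qed

end
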